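(* Let $m\ge 3$, let $I_1,\ldots,I_m\subset(0,1)$ be pairwise disjoint compact intervals and let $\mathcal{I}:=\bigcup_{i=1}^m I_i$. Let $$f(x,y,z)=(\gamma(x,z),\eta(y,z),\psi(z)),\qquad (x,y,z)\in[0,1]\times[0,1]\times\mathcal{I},$$ be a $\mathcal{C}^{1+\epsilon}$-transformation (for some $\epsilon>0$) such that $\lambda_1<|\gamma'_x|,|\eta'_y|<\lambda_2$ for some $0<\lambda_1<\lambda_2<1/2$, $|\psi'|>1$ on $\mathcal{I}$, and $\psi(I_i)=[0,1]$ for all $i=1,\ldots,m$. For $\tau=(\tau_{1,1},\tau_{1,2},\ldots,\tau_{m,1},\tau_{m,2})\in\mathbb{R}^{2m}$ define $$f_\tau(x,y,z):=(\gamma(x,z)+\tau_{i,1},\ \eta(y,z)+\tau_{i,2},\ \psi(z)),\qquad (x,y,z)\in[0,1]\times[0,1]\times I_i,\ 1\le i\le m.$$ Assume that $|\gamma'_x|=|\eta'_y|\equiv 1/m$ on $[0,1]\times\mathcal{I}$. Let $\Lambda_\tau:=\bigcap_{n\in\mathbb{Z}}f_\tau^n([0,1]^3)$ denote the associated basic set of $f_\tau$. Then, for Lebesgue-almost every $f$-admissible parameter $\tau$, there exists an open dense set $A_\tau$ in $\Lambda_\tau$ such that every $x\in A_\tau$ has precisely one $f_\tau$-preimage in $\Lambda_\tau$.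
   Context: A parameter $\tau\in\mathbb{R}^{2m}$ is called $f$-admissible if $f_\tau\big(\bigcup_{1\le i\le m}[0,1]^2\times I_i\big)\subset(0,1)^2\times[0,1]$. Here $\gamma'_x$ and $\eta'_y$ denote the partial derivatives of $\gamma$ with respect to $x$ and of $\eta$ with respect to $y$. In the definition of $\Lambda_\tau$, for $n\ge 0$ the set $f_\tau^n([0,1]^3)$ is the image under $f_\tau^n$ of the points at which $f_\tau^n$ is defined, and for $n<0$ it is the set of points at which $f_\tau^{|n|}$ is defined (with image in $[0,1]^3$). Open and dense are meant in the relative topology of $\Lambda_\tau$. Lebesgue-almost every refers to Lebesgue measure on $\mathbb{R}^{2m}$ restricted to the set of $f$-admissible parameters. *)

theory Defs
  imports "HOL-Analysis.Analysis"
begin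

text \<open>Differentiability is relative to \<open>S\<close>, hence one-sided at the boundary of a box.\<close>

definition C1_holder_on ::
  "real \<Rightarrow> ('a::real_normed_vector \<Rightarrow> 'b::real_normed_vector) \<Rightarrow> 'a set \<Rightarrow> bool" where
  "C1_holder_on \<epsilon> g S \<longleftrightarrow>
     (\<exists>g' :: 'a \<Rightarrow> 'a \<Rightarrow>\<^sub>L 'b.
        (\<forall>p\<in>S. (g has_derivative blinfun_apply (g' p)) (at p within S)) \<and>
        (\<exists>C. \<forall>p\<in>S. \<forall>q\<in>S. norm (g' p - g' q) \<le> C * dist p q powr \<epsilon>))"

abbreviation unit_cube :: "(real \<times> real \<times> real) set" where
  "unit_cube \<equiv> {0..1} \<times> {0..1} \<times> {0..1}"

definition fdom :: "('m \<Rightarrow> real set) \<Rightarrow> (real \<times> real \<times> real) set" where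
  "fdom I = {0..1} \<times> {0..1} \<times> (\<Union>i. I i)"

definition fmap ::
  "(real \<Rightarrow> real \<Rightarrow> real) \<Rightarrow> (real \<Rightarrow> real \<Rightarrow> real) \<Rightarrow> (real \<Rightarrow> real) \<Rightarrow>
   real \<times> real \<times> real \<Rightarrow> real \<times> real \<times> real" where
  "fmap \<gamma> \<eta> \<psi> = (\<lambda>(x, y, z). (\<gamma> x z, \<eta> y z, \<psi> z))"

text \<open>The parameter space \<open>\<real>\<^sup>2\<^sup>m\<close> is \<open>real^2^'m\<close>, with \<open>\<tau> $ i $ j\<close> in the role of \<open>\<tau>\<^sub>i\<^sub>,\<^sub>j\<close>.
  The maps \<open>fmap\<close> and \<open>ftau\<close> are total functions, but only their values on \<open>fdom I\<close> are
  meaningful; for pairwise disjoint \<open>I\<close>, the index below is unique there.\<close>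

definition ftau ::
  "('m::finite \<Rightarrow> real set) \<Rightarrow> (real \<Rightarrow> real \<Rightarrow> real) \<Rightarrow> (real \<Rightarrow> real \<Rightarrow> real) \<Rightarrow> (real \<Rightarrow> real) \<Rightarrow>
   real^2^'m \<Rightarrow> real \<times> real \<times> real \<Rightarrow> real \<times> real \<times> real" where
  "ftau I \<gamma> \<eta> \<psi> \<tau> = (\<lambda>(x, y, z).
     let i = (THE i. z \<in> I i) in (\<gamma> x z + \<tau> $ i $ 1, \<eta> y z + \<tau> $ i $ 2, \<psi> z))"

definition admissible ::
  "('m::finite \<Rightarrow> real set) \<Rightarrow> (real \<Rightarrow> real \<Rightarrow> real) \<Rightarrow> (real \<Rightarrow> real \<Rightarrow> real) \<Rightarrow> (real \<Rightarrow> real) \<Rightarrow>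
   real^2^'m \<Rightarrow> bool" where
  "admissible I \<gamma> \<eta> \<psi> \<tau> \<longleftrightarrow>
     ftau I \<gamma> \<eta> \<psi> \<tau> ` fdom I \<subseteq> {0<..<1} \<times> {0<..<1} \<times> {0..1}"

text \<open>Iterates of a map \<open>g\<close> defined only on \<open>D\<close>: \<open>iter_dom Q D g n\<close> consists of the points of
  \<open>Q\<close> at which the \<open>n\<close>-th iterate is defined, and \<open>iter_set Q D g n\<close> is the image of \<open>Q\<close>
  (\<open>n \<ge> 0\<close>) or its preimage (\<open>n < 0\<close>) under the iterate of order \<open>\<bar>n\<bar>\<close>.\<close>

definition iter_dom :: "'a set \<Rightarrow> 'a set \<Rightarrow> ('a \<Rightarrow> 'a) \<Rightarrow> nat \<Rightarrow> 'a set" where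
  "iter_dom Q D g n = {p \<in> Q. \<forall>k<n. (g ^^ k) p \<in> D}"

definition iter_set :: "'a set \<Rightarrow> 'a set \<Rightarrow> ('a \<Rightarrow> 'a) \<Rightarrow> int \<Rightarrow> 'a set" where
  "iter_set Q D g n =
     (if 0 \<le> n then (g ^^ nat n) ` iter_dom Q D g (nat n)
      else {p \<in> iter_dom Q D g (nat \<bar>n\<bar>). (g ^^ nat \<bar>n\<bar>) p \<in> Q})"

definition basic_set ::
  "('m::finite \<Rightarrow> real set) \<Rightarrow> (real \<Rightarrow> real \<Rightarrow> real) \<Rightarrow> (real \<Rightarrow> real \<Rightarrow> real) \<Rightarrow> (real \<Rightarrow> real) \<Rightarrow>
   real^2^'m \<Rightarrow> (real \<times> real \<times> real) set" where
  "basic_set I \<gamma> \<eta> \<psi> \<tau> = (\<Inter>n. iter_set unit_cube (fdom I) (ftau I \<gamma> \<eta> \<psi> \<tau>) n)"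

end

theory Submission
  imports Defs
begin

text \<open>
  The derivative hypothesis makes \<open>f\<close> affine in \<open>x\<close> and \<open>y\<close> with slopes \<open>\<plusminus>1/m\<close>, so the point of
  \<open>\<Lambda>\<^sub>\<tau>\<close> over \<open>z\<close> with symbolic past \<open>\<omega>\<close> is the limit of sums that are affine in \<open>\<tau>\<close>. Fix \<open>(\<omega>, z)\<close>.
  If another past \<open>\<omega>'\<close> with \<open>\<omega>' 0 \<noteq> \<omega> 0\<close> gives the same point, then for every \<open>n\<close> the parameter
  lies in one of at most \<open>m^n\<close> sets on which two affine functions of \<open>\<tau>\<close>, one for each of the two
  coordinates, are at most \<open>2 m^(-n)\<close> in absolute value. Because \<open>m \<ge> 3\<close>, these functions vary at a definite rate
  in the direction \<open>e\<^sub>i - e\<^sub>j\<close> with \<open>i = \<omega> 0\<close> and \<open>j = \<omega>' 0\<close>, so each set has measure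
  \<open>O(m^(-2n))\<close> on bounded sets and the exceptional parameters form a null set. Doing this for a countable set
  of pairs \<open>(\<omega>, z)\<close> whose points are dense in \<open>\<Lambda>\<^sub>\<tau>\<close> for every \<open>\<tau>\<close> shows that the closed set of
  points with two preimages has no interior.
\<close>

section \<open>Truncated fibre sums over a symbolic past\<close>

text \<open>\<open>c\<close>, \<open>a\<close>, \<open>t\<close> are the offset, slope and translation of the affine fibre maps and \<open>g i\<close> is the
  inverse branch of \<open>\<psi>\<close> into \<open>I i\<close>; \<open>\<omega> 0\<close> is the most recent symbol of the past.\<close>

primrec fiber_sum ::
  "(real \<Rightarrow> real) \<Rightarrow> (real \<Rightarrow> real) \<Rightarrow> ('m \<Rightarrow> real \<Rightarrow> real) \<Rightarrow> ('m \<Rightarrow> real) \<Rightarrow>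
   nat \<Rightarrow> (nat \<Rightarrow> 'm) \<Rightarrow> real \<Rightarrow> real" where
  "fiber_sum c a g t 0 \<omega> z = 0"
| "fiber_sum c a g t (Suc n) \<omega> z =
     c (g (\<omega> 0) z) + t (\<omega> 0) + a (g (\<omega> 0) z) * fiber_sum c a g t n (\<lambda>k. \<omega> (Suc k)) (g (\<omega> 0) z)"

text \<open>Each recursion step consumes one symbol, so at depth \<open>n\<close> an infinite past
  enters only through a word of length \<open>n\<close>. This leaves finitely many cases at each
  depth.\<close>

lemma fiber_sum_cong_prefix:
  assumes "\<And>k. k < n \<Longrightarrow> \<omega> k = \<omega>' k"
  shows "fiber_sum c a g t n \<omega> z = fiber_sum c a g t n \<omega>' z"
  using assms
proof (induction n arbitrary: \<omega> \<omega>' z)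
  case (Suc n)
  have "fiber_sum c a g t n (\<lambda>k. \<omega> (Suc k)) y = fiber_sum c a g t n (\<lambda>k. \<omega>' (Suc k)) y" for y
    by (rule Suc.IH) (simp add: Suc.prems)
  then show ?case using Suc.prems[of 0] by simp
qed simp

text \<open>Neither \<open>a\<close> nor \<open>g\<close> involves the translation, so the recursion
  is affine in it, and its linear part is the same recursion with zero offset. Hence moving
  \<open>t\<close> along \<open>u\<close> changes a sum at a constant rate.\<close>

lemma fiber_sum_linear:
  "fiber_sum c a g (\<lambda>k. t k + s * u k) n \<omega> z =
     fiber_sum c a g t n \<omega> z + s * fiber_sum (\<lambda>_. 0) a g u n \<omega> z"
  by (induction n arbitrary: \<omega> z) (simp_all add: algebra_simps)

lemma continuous_on_fiber_sum_param:
  assumes "\<And>k. continuous_on S (\<lambda>\<tau>. t \<tau> k)"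
  shows "continuous_on S (\<lambda>\<tau>. fiber_sum c a g (t \<tau>) n \<omega> z)"
  by (induction n arbitrary: \<omega> z) (auto intro!: continuous_intros assms)

section \<open>Contracting fibre maps in one coordinate\<close>

text \<open>Invariance of the unit interval depends on the translation \<open>t\<close> and is
  assumed only in a later context, because the measure estimates run over all parameters, admissible
  or not.\<close>

locale contracting_fibers =
  fixes g :: "'m \<Rightarrow> real \<Rightarrow> real" and c a :: "real \<Rightarrow> real" and q :: real
  assumes g_range: "z \<in> {0..1} \<Longrightarrow> g i z \<in> {0..1}"
    and g_cont: "continuous_on {0..1} (g i)"
    and c_cont: "continuous_on {0..1} (\<lambda>z. c (g i z))"
    and a_cont: "continuous_on {0..1} (\<lambda>z. a (g i z))"
    and a_abs: "z \<in> {0..1} \<Longrightarrow> \<bar>a (g i z)\<bar> = q"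
    and q_bounds: "0 < q" "q \<le> 1/3"
begin

abbreviation S where "S \<equiv> fiber_sum c a g"

lemma continuous_on_S: "continuous_on {0..1} (S t n \<omega>)"
proof (induction n arbitrary: \<omega>)
  case (Suc n)
  have "continuous_on {0..1} (\<lambda>z. S t n (\<lambda>k. \<omega> (Suc k)) (g (\<omega> 0) z))"
    by (rule continuous_on_compose2[OF Suc.IH g_cont]) (use g_range in auto)
  then show ?case by (auto intro!: continuous_intros c_cont a_cont)
qed simp

text \<open>The bound \<open>3/2\<close> solves s = 1 + s/3: it is the geometric series of ratio
  1/3, the largest contraction rate allowed.\<close>

lemma linear_part_bound:
  assumes "\<And>k. \<bar>u k\<bar> \<le> 1" "z \<in> {0..1}"
  shows "\<bar>fiber_sum (\<lambda>_. 0) a g u n \<omega> z\<bar> \<le> 3/2"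
  using assms(2)
proof (induction n arbitrary: \<omega> z)
  case (Suc n)
  let ?y = "g (\<omega> 0) z" and ?s = "fiber_sum (\<lambda>_. 0) a g u n (\<lambda>k. \<omega> (Suc k)) (g (\<omega> 0) z)"
  have "\<bar>a ?y * ?s\<bar> \<le> 1/3 * (3/2)"
    unfolding abs_mult using Suc g_range a_abs q_bounds by (intro mult_mono) auto
  then show ?case using assms(1)[of "\<omega> 0"] abs_triangle_ineq[of "u (\<omega> 0)" "a ?y * ?s"] by simp
qed simp

text \<open>The leading terms differ by 2 and each tail is at most \<open>1/3 * (3/2)\<close>, that
  is 1/2, so at least 1 remains. With contraction rate 1/2 the same estimate would leave only
  0.\<close>

lemma linear_part_transversal:
  assumes u: "\<And>k. \<bar>u k\<bar> \<le> 1" and z: "z \<in> {0..1}" and n: "n \<noteq> 0"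
    and "u (\<omega> 0) = 1" "u (\<omega>' 0) = -1"
  shows "fiber_sum (\<lambda>_. 0) a g u n \<omega> z - fiber_sum (\<lambda>_. 0) a g u n \<omega>' z \<ge> 1"
proof -
  obtain n' where [simp]: "n = Suc n'" using n by (cases n) auto
  have "\<bar>a (g (\<upsilon> 0) z) * fiber_sum (\<lambda>_. 0) a g u n' (\<lambda>k. \<upsilon> (Suc k)) (g (\<upsilon> 0) z)\<bar> \<le> 1/3 * (3/2)" for \<upsilon>
    unfolding abs_mult using z g_range a_abs q_bounds
    by (intro mult_mono linear_part_bound u) auto
  from this[of \<omega>] this[of \<omega>'] show ?thesis using assms(4,5) by simp
qed

text \<open>Unrolling the recursion \<open>n\<close> times expresses \<open>x 0\<close> through
  \<open>x n\<close>. The sum has 0 in place of \<open>x n\<close>, and this error of at most 1 is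
  multiplied by \<open>n\<close> slopes of size \<open>q\<close>.\<close>

lemma history_bound:
  assumes "\<And>k. z k \<in> {0..1}" "\<And>k. z (Suc k) = g (\<omega> k) (z k)"
    and "\<And>k. x k \<in> {0..1}"
    and "\<And>k. x k = c (z (Suc k)) + t (\<omega> k) + a (z (Suc k)) * x (Suc k)"
  shows "\<bar>x 0 - S t n \<omega> (z 0)\<bar> \<le> q ^ n"
  using assms
proof (induction n arbitrary: x z \<omega>)
  case 0
  show ?case using "0.prems"(3)[of 0] by simp
next
  case (Suc n)
  have IH: "\<bar>x (Suc 0) - S t n (\<lambda>k. \<omega> (Suc k)) (z (Suc 0))\<bar> \<le> q ^ n"
    by (rule Suc.IH) (rule Suc.prems)+
  have "x 0 - S t (Suc n) \<omega> (z 0) =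
      a (z (Suc 0)) * (x (Suc 0) - S t n (\<lambda>k. \<omega> (Suc k)) (z (Suc 0)))"
    using Suc.prems(2)[of 0] Suc.prems(4)[of 0] by (simp add: algebra_simps)
  moreover have "\<bar>a (z (Suc 0))\<bar> = q"
    using a_abs[OF Suc.prems(1)[of 0]] Suc.prems(2)[of 0] by simp
  ultimately show ?case using IH q_bounds by (simp add: abs_mult mult_left_mono)
qed

text \<open>\<open>lim\<close> is total; convergence is established in the context below, under
  invariance of the unit interval.\<close>

definition fiber_pt where "fiber_pt t \<omega> z = lim (\<lambda>n. S t n \<omega> z)"

context
  fixes t :: "'m \<Rightarrow> real"
  assumes invariant:
    "\<And>i z x. z \<in> {0..1} \<Longrightarrow> x \<in> {0..1} \<Longrightarrow> c (g i z) + t i + a (g i z) * x \<in> {0..1}"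
begin

lemma S_range: "z \<in> {0..1} \<Longrightarrow> S t n \<omega> z \<in> {0..1}"
proof (induction n arbitrary: \<omega> z)
  case (Suc n)
  then show ?case using invariant[OF Suc.prems Suc.IH[OF g_range[OF Suc.prems]]] by simp
qed simp

text \<open>Peeling off the most recent symbol leaves the same difference one depth lower,
  multiplied by a slope of size \<open>q\<close>. At depth 0 both sums lie in the unit
  interval.\<close>

lemma S_step: "z \<in> {0..1} \<Longrightarrow> \<bar>S t (Suc n) \<omega> z - S t n \<omega> z\<bar> \<le> q ^ n"
proof (induction n arbitrary: \<omega> z)
  case 0
  then show ?case using S_range[of z "Suc 0" \<omega>] by simp
next
  case (Suc n)
  let ?y = "g (\<omega> 0) z" and ?w = "\<lambda>k. \<omega> (Suc k)"
  have "S t (Suc (Suc n)) \<omega> z - S t (Suc n) \<omega> z = a ?y * (S t (Suc n) ?w ?y - S t n ?w ?y)"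
    by (simp add: algebra_simps)
  then show ?case using Suc.IH[OF g_range[OF Suc.prems], of ?w "\<omega> 0"] a_abs[OF Suc.prems] q_bounds
    by (simp only: abs_mult power_Suc mult_left_mono)
qed

lemma S_tendsto:
  assumes "z \<in> {0..1}"
  shows "(\<lambda>n. S t n \<omega> z) \<longlonglongrightarrow> fiber_pt t \<omega> z"
proof -
  have "summable (\<lambda>n. S t (Suc n) \<omega> z - S t n \<omega> z)"
    by (rule summable_comparison_test'[where g = "\<lambda>n. q ^ n" and N = 0])
       (use q_bounds S_step[OF assms] in \<open>auto intro!: summable_geometric\<close>)
  then have "convergent (\<lambda>n. \<Sum>k<n. S t (Suc k) \<omega> z - S t k \<omega> z)"
    by (simp add: summable_iff_convergent)
  then have "convergent (\<lambda>n. S t n \<omega> z)"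
    unfolding sum_lessThan_telescope[of "\<lambda>n. S t n \<omega> z"] by simp
  then show ?thesis by (simp add: fiber_pt_def convergent_LIMSEQ_iff)
qed

lemma fiber_pt_range:
  assumes "z \<in> {0..1}"
  shows "fiber_pt t \<omega> z \<in> {0..1}"
  by (rule closed_sequentially[OF closed_atLeastAtMost _ S_tendsto[OF assms]])
     (use S_range[OF assms] in auto)

lemma fiber_pt_rec:
  assumes "z \<in> {0..1}"
  shows "fiber_pt t \<omega> z =
    c (g (\<omega> 0) z) + t (\<omega> 0) + a (g (\<omega> 0) z) * fiber_pt t (\<lambda>k. \<omega> (Suc k)) (g (\<omega> 0) z)"
proof (rule LIMSEQ_unique)
  show "(\<lambda>n. S t (Suc n) \<omega> z) \<longlonglongrightarrow> fiber_pt t \<omega> z"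
    by (rule LIMSEQ_Suc[OF S_tendsto[OF assms]])
  show "(\<lambda>n. S t (Suc n) \<omega> z) \<longlonglongrightarrow>
      c (g (\<omega> 0) z) + t (\<omega> 0) + a (g (\<omega> 0) z) * fiber_pt t (\<lambda>k. \<omega> (Suc k)) (g (\<omega> 0) z)"
    unfolding fiber_sum.simps by (intro tendsto_intros S_tendsto g_range assms)
qed

lemma fiber_pt_approx: "z \<in> {0..1} \<Longrightarrow> \<bar>fiber_pt t \<omega> z - S t n \<omega> z\<bar> \<le> q ^ n"
proof (induction n arbitrary: \<omega> z)
  case 0
  then show ?case using fiber_pt_range[of z \<omega>] by simp
next
  case (Suc n)
  let ?y = "g (\<omega> 0) z" and ?w = "\<lambda>k. \<omega> (Suc k)"
  have "fiber_pt t \<omega> z - S t (Suc n) \<omega> z = a ?y * (fiber_pt t ?w ?y - S t n ?w ?y)"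
    by (simp add: algebra_simps fiber_pt_rec[OF Suc.prems])
  then show ?case using Suc.IH[OF g_range[OF Suc.prems], of ?w "\<omega> 0"] a_abs[OF Suc.prems] q_bounds
    by (simp only: abs_mult power_Suc mult_left_mono)
qed

text \<open>A backward orbit that stays in the unit interval has its end point forced by its
  symbols, since \<open>history_bound\<close> applies at every depth.\<close>

lemma history_unique:
  assumes "\<And>k. z k \<in> {0..1}" "\<And>k. z (Suc k) = g (\<omega> k) (z k)"
    and "\<And>k. x k \<in> {0..1}"
    and "\<And>k. x k = c (z (Suc k)) + t (\<omega> k) + a (z (Suc k)) * x (Suc k)"
  shows "x 0 = fiber_pt t \<omega> (z 0)"
proof (rule LIMSEQ_unique[OF _ S_tendsto])
  have "(\<lambda>n. x 0 - S t n \<omega> (z 0)) \<longlonglongrightarrow> 0"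
    by (rule Lim_null_comparison[OF _ LIMSEQ_realpow_zero[of q]])
       (use history_bound[of z \<omega> x t, OF assms] q_bounds in auto)
  then have "(\<lambda>n. x 0 - (x 0 - S t n \<omega> (z 0))) \<longlonglongrightarrow> x 0 - 0"
    by (intro tendsto_intros)
  then show "(\<lambda>n. S t n \<omega> (z 0)) \<longlonglongrightarrow> x 0" by simp
qed (rule assms)

end

end

section \<open>Measure of the parameters with coinciding fibre points\<close>

lemma packing_translates:
  fixes T W :: "'a::euclidean_space set"
  assumes "finite J" "T \<in> lmeasurable" "W \<in> lmeasurable"
    and sub: "\<And>j. j \<in> J \<Longrightarrow> (+) (v j) ` T \<subseteq> W"
    and disj: "pairwise (\<lambda>i j. disjnt ((+) (v i) ` T) ((+) (v j) ` T)) J"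
  shows "card J * measure lebesgue T \<le> measure lebesgue W"
proof -
  have meas: "(+) (v j) ` T \<in> lmeasurable" for j
    by (rule measurable_translation[OF assms(2)])
  have "card J * measure lebesgue T = (\<Sum>j\<in>J. measure lebesgue ((+) (v j) ` T))"
    by (simp add: measure_translation)
  also have "\<dots> = measure lebesgue (\<Union>j\<in>J. (+) (v j) ` T)"
    using measure_UNION'[OF assms(1) meas disj] by simp
  also have "\<dots> \<le> measure lebesgue W"
    using sub assms(1,3) meas by (intro measure_mono_fmeasurable) (auto intro!: fmeasurableD)
  finally show ?thesis .
qed

locale two_fibers =
  X: contracting_fibers g c1 a1 "1 / real CARD('m)" + Y: contracting_fibers g c2 a2 "1 / real CARD('m)"
  for g :: "'m::finite \<Rightarrow> real \<Rightarrow> real" and c1 a1 c2 a2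
begin

text \<open>The factor 2 is the triangle inequality: two equal limits are each within
  \<open>m^(-n)\<close> of their sums of depth \<open>n\<close>, where m is
  \<open>CARD('m)\<close>.\<close>

definition close_set :: "(nat \<Rightarrow> 'm) \<Rightarrow> (nat \<Rightarrow> 'm) \<Rightarrow> real \<Rightarrow> nat \<Rightarrow> (real^2^'m) set" where
  "close_set \<omega> \<omega>' z n = {\<tau>.
     \<bar>X.S (\<lambda>i. \<tau> $ i $ 1) n \<omega> z - X.S (\<lambda>i. \<tau> $ i $ 1) n \<omega>' z\<bar> \<le> 2 * (1 / real CARD('m)) ^ n \<and>
     \<bar>Y.S (\<lambda>i. \<tau> $ i $ 2) n \<omega> z - Y.S (\<lambda>i. \<tau> $ i $ 2) n \<omega>' z\<bar> \<le> 2 * (1 / real CARD('m)) ^ n}"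

lemma closed_close_set: "closed (close_set \<omega> \<omega>' z n)"
  unfolding close_set_def
  by (intro closed_Collect_conj closed_Collect_le continuous_intros continuous_on_fiber_sum_param)

text \<open>The \<open>N\<^sup>2\<close> translates by multiples of \<open>5 / N\<close> along the two transversal directions \<open>U 1\<close>, \<open>U 2\<close>
  are disjoint, which replaces an application of Fubini.\<close>

lemma close_set_measure:
  assumes z: "z \<in> {0..1}" and ne: "\<omega> 0 \<noteq> \<omega>' 0" and n: "n \<noteq> 0"
  shows "measure lebesgue (close_set \<omega> \<omega>' z n \<inter> cball 0 R) * (real CARD('m) ^ n)\<^sup>2
           \<le> measure lebesgue (cball 0 (R + 20) :: (real^2^'m) set)"
proof -
  define N where "N = CARD('m) ^ n"
  define T where "T = close_set \<omega> \<omega>' z n \<inter> cball 0 R"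
  \<comment> \<open>\<open>u\<close> lists the components of the direction from symbol
    \<open>\<omega>' 0\<close> to symbol \<open>\<omega> 0\<close>. \<open>U l\<close> carries it in
    planar coordinate \<open>l\<close> only, so shifts along \<open>U 1\<close> and
    \<open>U 2\<close> act on the two coordinates separately.\<close>
  define u :: "'m \<Rightarrow> real" where "u = (\<lambda>k. if k = \<omega> 0 then 1 else if k = \<omega>' 0 then -1 else 0)"
  define U :: "2 \<Rightarrow> real^2^'m" where "U l = axis (\<omega> 0) (axis l 1) - axis (\<omega>' 0) (axis l 1)" for l
  define v :: "nat \<times> nat \<Rightarrow> real^2^'m" where
    "v = (\<lambda>(p, r). (5 * (real p / N)) *\<^sub>R U 1 + (5 * (real r / N)) *\<^sub>R U 2)"
  have N0: "N > 0" by (simp add: N_def)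
  have u: "\<bar>u k\<bar> \<le> 1" "u (\<omega> 0) = 1" "u (\<omega>' 0) = -1" for k
    using ne by (auto simp: u_def)
  have U: "U l $ k $ l' = (if l = l' then u k else 0)" for l l' k
    using ne by (auto simp: U_def u_def axis_def)
  have normU: "norm (U l) \<le> 2" for l
  proof -
    have "norm (axis i (axis l 1) :: real^2^'m) = 1" for i
      by (simp add: norm_eq_sqrt_inner inner_axis_axis)
    then show ?thesis unfolding U_def by (metis norm_triangle_ineq4 one_add_one)
  qed
  have v1: "v (p, r) $ k $ 1 = (5 * (real p / N)) * u k" for p r k
    by (simp add: v_def U)
  have v2: "v (p, r) $ k $ 2 = (5 * (real r / N)) * u k" for p r k
    by (simp add: v_def U)
  have compactT: "compact T"
    unfolding T_def by (intro closed_Int_compact closed_close_set compact_cball)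
  \<comment> \<open>Each coefficient is at most 5 and each direction has norm at most 2, so the two
    terms contribute at most 10 each; this explains the radius \<open>R + 20\<close>.\<close>
  have norm_v: "norm (v j) \<le> 20" if jN: "j \<in> {..<N} \<times> {..<N}" for j
  proof -
    obtain p r where j: "j = (p, r)" "p < N" "r < N" using jN by (cases j) auto
    have *: "norm ((5 * (real s / N)) *\<^sub>R U l) \<le> 10" if "s < N" for s l
    proof -
      have "real s / N \<le> 1" using that by simp
      then have "(5 * (real s / N)) * norm (U l) \<le> 5 * 2"
        using normU[of l] by (intro mult_mono) auto
      then show ?thesis by simp
    qed
    show ?thesis unfolding j(1) v_def prod.case
      using norm_triangle_ineq[of "(5 * (real p / N)) *\<^sub>R U 1" "(5 * (real r / N)) *\<^sub>R U 2"]
        *[OF j(2), of 1] *[OF j(3), of 2] by linarith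
  qed
  \<comment> \<open>Distinct grid shifts change a quantity of rate \<open>\<kappa> \<ge> 1\<close>
    by amounts at least \<open>5 / N\<close> apart, while two values of size at most
    \<open>2 / N\<close> can compensate only \<open>4 / N\<close>. This is why the grid has step
    \<open>5 / N\<close>.\<close>
  have sep: "s = s'"
    if "\<bar>d + (5 * (real s / N)) * \<kappa> - (d' + (5 * (real s' / N)) * \<kappa>)\<bar> = 0"
      "\<kappa> \<ge> 1" "\<bar>d\<bar> \<le> 2 / N" "\<bar>d'\<bar> \<le> 2 / N" for s s' :: nat and d d' \<kappa> :: real
  proof (rule ccontr)
    assume "s \<noteq> s'"
    then have "1 \<le> \<bar>real s - real s'\<bar>" by linarith
    then have "1 * 1 \<le> \<bar>real s - real s'\<bar> * \<kappa>" using that(2) by (intro mult_mono) auto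
    then have "5 / N \<le> 5 / N * (\<bar>real s - real s'\<bar> * \<kappa>)" by (intro mult_le_cancel_left1[THEN iffD2]) auto
    also have "\<dots> = \<bar>(5 * (real s / N)) * \<kappa> - (5 * (real s' / N)) * \<kappa>\<bar>"
    proof -
      have "(5 * (real s / N)) * \<kappa> - (5 * (real s' / N)) * \<kappa> = 5 / N * ((real s - real s') * \<kappa>)"
        by (simp add: algebra_simps diff_divide_distrib)
      then show ?thesis using that(2) by (simp add: abs_mult)
    qed
    also have "\<dots> \<le> \<bar>d\<bar> + \<bar>d'\<bar>"
    proof -
      have "\<bar>e - e'\<bar> \<le> \<bar>d\<bar> + \<bar>d'\<bar>" if "\<bar>d + e - (d' + e')\<bar> = 0" for e e' :: real
        using that by linarith
      from this[OF that(1)] show ?thesis .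
    qed
    also have "\<dots> \<le> 4 / N" using that(3,4) by simp
    finally show False using N0 by (simp add: divide_le_cancel)
  qed
  have q: "(1 / real CARD('m)) ^ n = 1 / N" by (simp add: N_def power_one_over)
  have "card ({..<N} \<times> {..<N}) * measure lebesgue T \<le> measure lebesgue (cball 0 (R + 20) :: (real^2^'m) set)"
  proof (rule packing_translates)
    show "T \<in> lmeasurable" by (rule lmeasurable_compact[OF compactT])
    show "(+) (v j) ` T \<subseteq> cball 0 (R + 20)" if "j \<in> {..<N} \<times> {..<N}" for j
    proof
      fix y assume "y \<in> (+) (v j) ` T"
      then obtain \<tau> where "\<tau> \<in> T" "y = v j + \<tau>" by auto
      then show "y \<in> cball 0 (R + 20)"
        using norm_v[OF that] norm_triangle_ineq[of "v j" \<tau>] by (auto simp: T_def)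
    qed
    show "pairwise (\<lambda>i j. disjnt ((+) (v i) ` T) ((+) (v j) ` T)) ({..<N} \<times> {..<N})"
    proof (rule pairwiseI, rule ccontr)
      fix j j' assume "j \<noteq> j'" and nd: "\<not> disjnt ((+) (v j) ` T) ((+) (v j') ` T)"
      obtain p r p' r' where j: "j = (p, r)" "j' = (p', r')" by (cases j, cases j') auto
      obtain \<tau> \<tau>' where T: "\<tau> \<in> T" "\<tau>' \<in> T" and eq: "\<tau> + v j = \<tau>' + v j'"
        using nd by (auto simp: disjnt_def add.commute)
      have eq1: "\<tau> $ k $ 1 + (5 * (real p / N)) * u k = \<tau>' $ k $ 1 + (5 * (real p' / N)) * u k"
        and eq2: "\<tau> $ k $ 2 + (5 * (real r / N)) * u k = \<tau>' $ k $ 2 + (5 * (real r' / N)) * u k" for k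
        using arg_cong[OF eq, of "\<lambda>x. x $ k $ 1"] arg_cong[OF eq, of "\<lambda>x. x $ k $ 2"]
        by (simp_all add: j v1 v2)
      have "p = p'"
      proof (rule sep)
        let ?D = "\<lambda>\<tau>. X.S (\<lambda>i. \<tau> $ i $ 1) n \<omega> z - X.S (\<lambda>i. \<tau> $ i $ 1) n \<omega>' z"
        let ?\<kappa> = "fiber_sum (\<lambda>_. 0) a1 g u n \<omega> z - fiber_sum (\<lambda>_. 0) a1 g u n \<omega>' z"
        show "?\<kappa> \<ge> 1" by (rule X.linear_part_transversal[of u z n \<omega> \<omega>', OF u(1) z n u(2,3)])
        show "\<bar>?D \<tau>\<bar> \<le> 2 / N" "\<bar>?D \<tau>'\<bar> \<le> 2 / N"
          using T by (auto simp: T_def close_set_def q)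
        \<comment> \<open>By linearity, adding \<open>s\<close> times the rate to the difference
          amounts to evaluating it at the parameter moved by \<open>s * u\<close>, so
          \<open>eq1\<close> equates both sides.\<close>
        have shift: "?D \<sigma> + s * ?\<kappa> = X.S (\<lambda>k. \<sigma> $ k $ 1 + s * u k) n \<omega> z - X.S (\<lambda>k. \<sigma> $ k $ 1 + s * u k) n \<omega>' z"
          for \<sigma> s
          unfolding fiber_sum_linear by (simp add: algebra_simps)
        show "\<bar>?D \<tau> + (5 * (real p / N)) * ?\<kappa> - (?D \<tau>' + (5 * (real p' / N)) * ?\<kappa>)\<bar> = 0"
          unfolding shift eq1 by simp
      qed
      moreover have "r = r'"
      proof (rule sep)
        let ?D = "\<lambda>\<tau>. Y.S (\<lambda>i. \<tau> $ i $ 2) n \<omega> z - Y.S (\<lambda>i. \<tau> $ i $ 2) n \<omega>' z"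
        let ?\<kappa> = "fiber_sum (\<lambda>_. 0) a2 g u n \<omega> z - fiber_sum (\<lambda>_. 0) a2 g u n \<omega>' z"
        show "?\<kappa> \<ge> 1" by (rule Y.linear_part_transversal[of u z n \<omega> \<omega>', OF u(1) z n u(2,3)])
        show "\<bar>?D \<tau>\<bar> \<le> 2 / N" "\<bar>?D \<tau>'\<bar> \<le> 2 / N"
          using T by (auto simp: T_def close_set_def q)
        have shift: "?D \<sigma> + s * ?\<kappa> = Y.S (\<lambda>k. \<sigma> $ k $ 2 + s * u k) n \<omega> z - Y.S (\<lambda>k. \<sigma> $ k $ 2 + s * u k) n \<omega>' z"
          for \<sigma> s
          unfolding fiber_sum_linear by (simp add: algebra_simps)
        show "\<bar>?D \<tau> + (5 * (real r / N)) * ?\<kappa> - (?D \<tau>' + (5 * (real r' / N)) * ?\<kappa>)\<bar> = 0"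
          unfolding shift eq2 by simp
      qed
      ultimately show False using \<open>j \<noteq> j'\<close> j by simp
    qed
  qed auto
  then show ?thesis by (simp add: T_def N_def power2_eq_square mult.commute)
qed

text \<open>Equality of limits is encoded through all finite depths, which makes sense for every
  parameter; the limits themselves are controlled only for admissible ones.\<close>

definition coincidence :: "(nat \<Rightarrow> 'm) \<Rightarrow> real \<Rightarrow> (real^2^'m) set" where
  "coincidence \<omega> z = {\<tau>. \<exists>\<omega>'. \<omega>' 0 \<noteq> \<omega> 0 \<and> (\<forall>n. \<tau> \<in> close_set \<omega> \<omega>' z n)}"

text \<open>The uncountably many pasts \<open>\<omega>'\<close> reduce at depth \<open>n\<close> to
  at most \<open>m^n\<close> words, each responsible for measure at most
  \<open>M / (m ^ n)\<^sup>2\<close>. The total \<open>M * (1 / m) ^ n\<close> tends to 0.\<close>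

lemma negligible_coincidence:
  assumes z: "z \<in> {0..1}"
  shows "negligible (coincidence \<omega> z)" (is "negligible ?B")
proof -
  have "negligible (?B \<inter> cball 0 (real R))" for R :: nat
    unfolding negligible_outer_le
  proof (intro allI impI)
    fix e :: real assume e: "e > 0"
    define M where "M = measure lebesgue (cball 0 (real R + 20) :: (real^2^'m) set)"
    define m where "m = real CARD('m)"
    have m: "m > 1" using X.q_bounds by (simp add: m_def field_simps)
    have "(\<lambda>n. M * (1 / m) ^ n) \<longlonglongrightarrow> M * 0"
      using m by (intro tendsto_intros LIMSEQ_realpow_zero) auto
    then have "\<forall>\<^sub>F n in sequentially. M * (1 / m) ^ n < e"
      using e by (auto dest!: order_tendstoD)
    \<comment> \<open>Positive depth is needed for the first symbols to enter the sums, and for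
      \<open>xs ! 0\<close> to lie inside the word.\<close>
    then obtain n where n: "n \<noteq> 0" "M * (1 / m) ^ n < e"
      using eventually_conj[OF _ eventually_gt_at_top[of 0]]
      by (metis (mono_tags, lifting) eventually_gt_at_top eventually_happens' eventually_elim2
          less_irrefl sequentially_bot trivial_limit_sequentially)
    define L where "L = {xs :: 'm list. set xs \<subseteq> UNIV \<and> length xs = n}"
    define L0 where "L0 = {xs \<in> L. xs ! 0 \<noteq> \<omega> 0}"
    \<comment> \<open>Entries \<open>xs ! k\<close> beyond the length are unspecified, which is
      harmless because depth \<open>n\<close> reads only \<open>k < n\<close>.\<close>
    define V where "V xs = close_set \<omega> (\<lambda>k. xs ! k) z n \<inter> cball 0 (real R)" for xs
    have finL: "finite L" unfolding L_def by (rule finite_lists_length_eq) simp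
    have cardL: "real (card L) = m ^ n"
      unfolding L_def using card_lists_length_eq[of "UNIV :: 'm set" n] by (simp add: m_def)
    have finL0: "finite L0" "card L0 \<le> card L"
      using finL by (auto simp: L0_def intro!: card_mono)
    have measV: "V xs \<in> lmeasurable" for xs
      unfolding V_def by (intro lmeasurable_compact closed_Int_compact closed_close_set compact_cball)
    have V_le: "measure lebesgue (V xs) \<le> M / (m ^ n)\<^sup>2" if "xs \<in> L0" for xs
    proof -
      have "\<omega> 0 \<noteq> xs ! 0" using that by (auto simp: L0_def)
      from close_set_measure[of z \<omega> "\<lambda>k. xs ! k" n "real R", OF z this n(1)] show ?thesis
        using m by (simp add: V_def M_def m_def field_simps)
    qed
    have "?B \<inter> cball 0 (real R) \<subseteq> (\<Union>xs\<in>L0. V xs)"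
    proof
      fix \<tau> assume "\<tau> \<in> ?B \<inter> cball 0 (real R)"
      then obtain \<omega>' where \<omega>': "\<omega>' 0 \<noteq> \<omega> 0" "\<tau> \<in> close_set \<omega> \<omega>' z n" "\<tau> \<in> cball 0 (real R)"
        unfolding coincidence_def by blast
      define xs where "xs = map \<omega>' [0..<n]"
      have "fiber_sum c a g t n \<omega>' z = fiber_sum c a g t n (\<lambda>k. xs ! k) z" for c a t
        by (rule fiber_sum_cong_prefix) (simp add: xs_def)
      then have "\<tau> \<in> V xs" using \<omega>'(2,3) by (simp add: V_def close_set_def)
      moreover have "xs \<in> L0" using \<omega>'(1) n(1) by (simp add: L0_def L_def xs_def)
      ultimately show "\<tau> \<in> (\<Union>xs\<in>L0. V xs)" by blast
    qed
    moreover have "(\<Union>xs\<in>L0. V xs) \<in> lmeasurable"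
      using finL0 measV by (intro fmeasurable.finite_UN) auto
    moreover have "measure lebesgue (\<Union>xs\<in>L0. V xs) \<le> e"
    proof -
      have "measure lebesgue (\<Union>xs\<in>L0. V xs) \<le> (\<Sum>xs\<in>L0. measure lebesgue (V xs))"
        using finL0 measV by (intro measure_UNION_le) (auto intro: fmeasurableD)
      also have "\<dots> \<le> real (card L0) * (M / (m ^ n)\<^sup>2)"
        by (rule sum_bounded_above) (rule V_le)
      also have "\<dots> \<le> real (card L) * (M / (m ^ n)\<^sup>2)"
        using finL0(2) by (intro mult_right_mono) (auto simp: M_def)
      also have "\<dots> = M * (1 / m) ^ n"
        using m by (simp add: cardL power2_eq_square field_simps power_one_over)
      finally show ?thesis using n(2) by simp
    qed
    ultimately show "\<exists>T. ?B \<inter> cball 0 (real R) \<subseteq> T \<and> T \<in> lmeasurable \<and> measure lebesgue T \<le> e"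
      by blast
  qed
  then have "negligible (\<Union>R::nat. ?B \<inter> cball 0 (real R))" by blast
  moreover have "?B \<subseteq> (\<Union>R::nat. ?B \<inter> cball 0 (real R))"
    using real_arch_simple by fastforce
  ultimately show ?thesis by (rule negligible_subset)
qed

end

section \<open>The skew product and its inverse branches\<close>

text \<open>The fibre maps are affine, so their offset and slope are read off from the values at 0
  and 1. Continuity in \<open>z\<close> is therefore recorded at these two end points.\<close>

locale skew_product =
  fixes I :: "'m::finite \<Rightarrow> real set" and \<gamma> \<eta> :: "real \<Rightarrow> real \<Rightarrow> real" and \<psi> :: "real \<Rightarrow> real"
  assumes card_ge_3: "CARD('m) \<ge> 3"
    and compact_I: "compact (I i)"
    and I_unit: "I i \<subseteq> {0..1}"
    and I_disjoint: "i \<noteq> j \<Longrightarrow> I i \<inter> I j = {}"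
    and \<psi>_inj: "inj_on \<psi> (I i)"
    and \<psi>_onto: "\<psi> ` I i = {0..1}"
    and \<psi>_cont: "continuous_on (\<Union>i. I i) \<psi>"
    and \<gamma>_cont: "x \<in> {0, 1} \<Longrightarrow> continuous_on (\<Union>i. I i) (\<gamma> x)"
    and \<eta>_cont: "x \<in> {0, 1} \<Longrightarrow> continuous_on (\<Union>i. I i) (\<eta> x)"
    and \<gamma>_affine: "x \<in> {0..1} \<Longrightarrow> z \<in> (\<Union>i. I i) \<Longrightarrow> \<gamma> x z = \<gamma> 0 z + (\<gamma> 1 z - \<gamma> 0 z) * x"
    and \<eta>_affine: "x \<in> {0..1} \<Longrightarrow> z \<in> (\<Union>i. I i) \<Longrightarrow> \<eta> x z = \<eta> 0 z + (\<eta> 1 z - \<eta> 0 z) * x"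
    and \<gamma>_slope: "z \<in> (\<Union>i. I i) \<Longrightarrow> \<bar>\<gamma> 1 z - \<gamma> 0 z\<bar> = 1 / real CARD('m)"
    and \<eta>_slope: "z \<in> (\<Union>i. I i) \<Longrightarrow> \<bar>\<eta> 1 z - \<eta> 0 z\<bar> = 1 / real CARD('m)"
begin

definition branch :: "'m \<Rightarrow> real \<Rightarrow> real" where "branch i = the_inv_into (I i) \<psi>"

lemma branch_in: "z \<in> {0..1} \<Longrightarrow> branch i z \<in> I i"
  unfolding branch_def using the_inv_into_into[OF \<psi>_inj[of i]] \<psi>_onto[of i] by blast

lemma \<psi>_branch: "z \<in> {0..1} \<Longrightarrow> \<psi> (branch i z) = z"
  unfolding branch_def using f_the_inv_into_f[OF \<psi>_inj[of i]] \<psi>_onto[of i] by blast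

lemma branch_\<psi>: "z \<in> I i \<Longrightarrow> branch i (\<psi> z) = z"
  unfolding branch_def by (rule the_inv_into_f_f[OF \<psi>_inj])

lemma \<psi>_range: "z \<in> I i \<Longrightarrow> \<psi> z \<in> {0..1}"
  using \<psi>_onto[of i] by blast

lemma branch_cont: "continuous_on {0..1} (branch i)"
  using continuous_on_inv_into[OF continuous_on_subset[OF \<psi>_cont] compact_I \<psi>_inj, of i]
  by (simp add: branch_def \<psi>_onto UN_upper)

lemma branch_compose_cont:
  "continuous_on (\<Union>i. I i) h \<Longrightarrow> continuous_on {0..1} (\<lambda>z. h (branch i z))"
  by (erule continuous_on_compose2[OF _ branch_cont]) (use branch_in in blast)

abbreviation "\<gamma>slope z \<equiv> \<gamma> 1 z - \<gamma> 0 z"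
abbreviation "\<eta>slope z \<equiv> \<eta> 1 z - \<eta> 0 z"

sublocale two_fibers branch "\<gamma> 0" "\<lambda>z. \<gamma>slope z" "\<eta> 0" "\<lambda>z. \<eta>slope z"
proof unfold_locales
  show "branch i z \<in> {0..1}" if "z \<in> {0..1}" for i z
    using branch_in[OF that] I_unit by blast
  show "continuous_on {0..1} (branch i)" for i by (rule branch_cont)
  show "continuous_on {0..1} (\<lambda>z. \<gamma> 0 (branch i z))" "continuous_on {0..1} (\<lambda>z. \<eta> 0 (branch i z))"
    "continuous_on {0..1} (\<lambda>z. \<gamma>slope (branch i z))" "continuous_on {0..1} (\<lambda>z. \<eta>slope (branch i z))" for i
    by (intro continuous_on_diff branch_compose_cont \<gamma>_cont \<eta>_cont; simp)+
  show "\<bar>\<gamma>slope (branch i z)\<bar> = 1 / real CARD('m)" "\<bar>\<eta>slope (branch i z)\<bar> = 1 / real CARD('m)"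
    if "z \<in> {0..1}" for i z
    using \<gamma>_slope \<eta>_slope branch_in[OF that] by blast+
  show "0 < 1 / real CARD('m)" "1 / real CARD('m) \<le> 1/3"
    using card_ge_3 by (simp_all add: field_simps)
qed

lemma the_index: "z \<in> I i \<Longrightarrow> (THE i. z \<in> I i) = i"
  using I_disjoint by blast

lemma ftau_eq:
  assumes "x \<in> {0..1}" "y \<in> {0..1}" "z \<in> I i"
  shows "ftau I \<gamma> \<eta> \<psi> \<tau> (x, y, z) =
    (\<gamma> 0 z + \<tau> $ i $ 1 + \<gamma>slope z * x, \<eta> 0 z + \<tau> $ i $ 2 + \<eta>slope z * y, \<psi> z)"
  using \<gamma>_affine[OF assms(1)] \<eta>_affine[OF assms(2)] assms(3)
  by (auto simp: ftau_def the_index Let_def algebra_simps)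

definition slab :: "'m \<Rightarrow> (real \<times> real \<times> real) set" where "slab i = {0..1} \<times> {0..1} \<times> I i"

lemma fdom_slabs: "fdom I = (\<Union>i. slab i)"
  by (auto simp: fdom_def slab_def)

lemma compact_slab: "compact (slab i)"
  unfolding slab_def by (intro compact_Times compact_Icc compact_I)

lemma closed_fdom: "closed (fdom I)"
  unfolding fdom_slabs by (intro closed_UN ballI compact_imp_closed compact_slab) simp

lemma fdom_cube: "fdom I \<subseteq> unit_cube"
  using I_unit by (auto simp: fdom_def)

lemma slab_fdom: "p \<in> slab i \<Longrightarrow> p \<in> fdom I"
  by (auto simp: fdom_slabs)

lemma slab_slope_nonzero: "z \<in> I i \<Longrightarrow> \<gamma>slope z \<noteq> 0" "z \<in> I i \<Longrightarrow> \<eta>slope z \<noteq> 0"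
  using \<gamma>_slope[of z] \<eta>_slope[of z] by fastforce+

lemma inj_on_slab: "inj_on (ftau I \<gamma> \<eta> \<psi> \<tau>) (slab i)"
proof (rule inj_onI)
  fix p p' assume p: "p \<in> slab i" "p' \<in> slab i" and eq: "ftau I \<gamma> \<eta> \<psi> \<tau> p = ftau I \<gamma> \<eta> \<psi> \<tau> p'"
  obtain x y z x' y' z' where [simp]: "p = (x, y, z)" "p' = (x', y', z')" by (cases p, cases p') auto
  have xyz: "x \<in> {0..1}" "y \<in> {0..1}" "z \<in> I i" "x' \<in> {0..1}" "y' \<in> {0..1}" "z' \<in> I i"
    using p by (auto simp: slab_def)
  have "z = z'" using eq xyz inj_onD[OF \<psi>_inj[of i]] by (simp add: ftau_eq[of _ _ _ i])
  then show "p = p'" using eq xyz slab_slope_nonzero[of z i] by (simp add: ftau_eq[of _ _ _ i])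
qed

text \<open>The translation jumps from one interval to another, but the slabs are closed and finite
  in number, so continuity can be checked on each slab, where a single formula holds.\<close>

lemma ftau_cont: "continuous_on (fdom I) (ftau I \<gamma> \<eta> \<psi> \<tau>)"
  unfolding fdom_slabs
proof (rule continuous_on_closed_Union)
  fix i
  have sub: "(\<lambda>p::real\<times>real\<times>real. snd (snd p)) ` slab i \<subseteq> (\<Union>i. I i)"
    by (auto simp: slab_def)
  have comp: "continuous_on (slab i) (\<lambda>p. h (snd (snd p)))" if "continuous_on (\<Union>i. I i) h" for h :: "real \<Rightarrow> real"
    by (rule continuous_on_compose2[OF that _ sub]) (intro continuous_intros)
  have "continuous_on (slab i) (\<lambda>p. (\<gamma> 0 (snd (snd p)) + \<tau> $ i $ 1 + \<gamma>slope (snd (snd p)) * fst p,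
      \<eta> 0 (snd (snd p)) + \<tau> $ i $ 2 + \<eta>slope (snd (snd p)) * fst (snd p), \<psi> (snd (snd p))))"
    by (intro continuous_on_Pair continuous_on_add continuous_on_mult continuous_on_diff
        continuous_on_const comp \<gamma>_cont \<eta>_cont \<psi>_cont)
       (auto intro!: continuous_intros)
  then show "continuous_on (slab i) (ftau I \<gamma> \<eta> \<psi> \<tau>)"
    by (rule continuous_on_eq) (auto simp: slab_def ftau_eq[of _ _ _ i])
qed (use compact_imp_closed[OF compact_slab] in auto)

text \<open>Padding finite words with one fixed symbol yields countably many pasts that realise
  every finite prefix.\<close>

definition word :: "'m list \<Rightarrow> nat \<Rightarrow> 'm" where
  "word xs k = (if k < length xs then xs ! k else undefined)"

text \<open>These are the heights of the points of the basic set of any admissible parameter. The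
  set does not depend on \<open>\<tau>\<close>, so one countable dense subset serves all
  parameters.\<close>

definition persistent :: "real set" where
  "persistent = {z \<in> {0..1}. \<forall>n. (\<psi> ^^ n) z \<in> (\<Union>i. I i)}"

lemma persistent_branch: "z \<in> persistent \<Longrightarrow> branch i z \<in> persistent"
proof -
  assume z: "z \<in> persistent"
  have b: "branch i z \<in> I i" "\<psi> (branch i z) = z"
    using z branch_in \<psi>_branch by (auto simp: persistent_def)
  have "(\<psi> ^^ n) (branch i z) \<in> (\<Union>i. I i)" for n
    using b z by (cases n) (auto simp: persistent_def funpow_swap1)
  moreover have "branch i z \<in> {0..1}" using b(1) I_unit by blast
  ultimately show ?thesis by (simp add: persistent_def)
qed

section \<open>The basic set of an admissible parameter\<close>

context
  fixes \<tau> :: "real^2^'m"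
  assumes adm: "admissible I \<gamma> \<eta> \<psi> \<tau>"
begin

abbreviation "F \<equiv> ftau I \<gamma> \<eta> \<psi> \<tau>"
abbreviation "\<Lambda> \<equiv> basic_set I \<gamma> \<eta> \<psi> \<tau>"
abbreviation "dom_iter \<equiv> iter_dom unit_cube (fdom I) F"
abbreviation "image_iter n \<equiv> (F ^^ n) ` dom_iter n"

lemma F_cube: "p \<in> fdom I \<Longrightarrow> F p \<in> unit_cube"
proof -
  assume "p \<in> fdom I"
  then have "F p \<in> {0<..<1} \<times> {0<..<1} \<times> {0..1}" using adm by (auto simp: admissible_def)
  then show ?thesis by auto
qed

lemma F_snd: "snd (snd (F p)) = \<psi> (snd (snd p))"
  by (cases p) (simp add: ftau_def Let_def)

lemma F_iter_snd: "snd (snd ((F ^^ n) p)) = (\<psi> ^^ n) (snd (snd p))"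
  by (induction n) (simp_all add: F_snd)

lemma invariant_x:
  assumes "z \<in> {0..1}" "x \<in> {0..1}"
  shows "\<gamma> 0 (branch i z) + \<tau> $ i $ 1 + \<gamma>slope (branch i z) * x \<in> {0..1}"
  using F_cube[of "(x, 0, branch i z)"] branch_in[OF assms(1), of i] assms
  by (auto simp: fdom_def ftau_eq[of x 0 _ i])

lemma invariant_y:
  assumes "z \<in> {0..1}" "y \<in> {0..1}"
  shows "\<eta> 0 (branch i z) + \<tau> $ i $ 2 + \<eta>slope (branch i z) * y \<in> {0..1}"
  using F_cube[of "(0, y, branch i z)"] branch_in[OF assms(1), of i] assms
  by (auto simp: fdom_def ftau_eq[of 0 y _ i])

lemma basic_set_iff:
  "p \<in> \<Lambda> \<longleftrightarrow> (\<forall>n. p \<in> image_iter n) \<and> (\<forall>n. (F ^^ n) p \<in> fdom I)"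
proof
  assume p: "p \<in> \<Lambda>"
  have iter: "p \<in> iter_set unit_cube (fdom I) F k" for k using p by (simp add: basic_set_def)
  have "p \<in> image_iter n" for n
    using iter[of "int n"] by (simp add: iter_set_def)
  \<comment> \<open>The iterate of order \<open>n\<close> being defined constrains only orbit points
    of index below \<open>n\<close>, hence the order \<open>Suc n\<close>.\<close>
  moreover have "(F ^^ n) p \<in> fdom I" for n
    using iter[of "- int (Suc n)"] by (simp add: iter_set_def iter_dom_def del: of_nat_Suc)
  ultimately show "(\<forall>n. p \<in> image_iter n) \<and> (\<forall>n. (F ^^ n) p \<in> fdom I)" by blast
next
  assume p: "(\<forall>n. p \<in> image_iter n) \<and> (\<forall>n. (F ^^ n) p \<in> fdom I)"
  then have cube: "(F ^^ n) p \<in> unit_cube" for n using fdom_cube by blast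
  have "p \<in> iter_set unit_cube (fdom I) F n" for n
    using p cube cube[of 0] by (auto simp: iter_set_def iter_dom_def)
  then show "p \<in> \<Lambda>" by (simp add: basic_set_def)
qed

lemma basic_set_fdom: "p \<in> \<Lambda> \<Longrightarrow> p \<in> fdom I"
  using basic_set_iff[of p] funpow_0 by metis

lemma basic_set_persistent: "p \<in> \<Lambda> \<Longrightarrow> snd (snd p) \<in> persistent"
proof -
  assume p: "p \<in> \<Lambda>"
  have "(\<psi> ^^ n) (snd (snd p)) \<in> (\<Union>i. I i)" for n
  proof -
    have "(F ^^ n) p \<in> fdom I" using p basic_set_iff by blast
    then show ?thesis unfolding fdom_def mem_Times_iff F_iter_snd by blast
  qed
  moreover have "snd (snd p) \<in> {0..1}"
    using basic_set_fdom[OF p] fdom_cube by (auto simp: mem_Times_iff)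
  ultimately show ?thesis by (simp add: persistent_def)
qed

text \<open>Dropping the first point of an orbit leaves one that starts at \<open>F r\<close>, which
  is again in the cube by admissibility, and has the same end.\<close>

lemma image_iter_Suc_subset: "image_iter (Suc n) \<subseteq> image_iter n"
proof
  fix p assume "p \<in> image_iter (Suc n)"
  then obtain r where r: "r \<in> dom_iter (Suc n)" "p = (F ^^ n) (F r)" by (auto simp: funpow_swap1)
  have "r \<in> fdom I" using r(1) by (auto simp: iter_dom_def dest: spec[of _ 0])
  moreover have "(F ^^ k) (F r) \<in> fdom I" if "k < n" for k
    using r(1) that by (auto simp: iter_dom_def funpow_swap1 dest: spec[of _ "Suc k"])
  ultimately have "F r \<in> dom_iter n" using F_cube by (auto simp: iter_dom_def)
  then show "p \<in> image_iter n" using r(2) by blast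
qed

lemma image_iter_antimono: "m \<le> n \<Longrightarrow> image_iter n \<subseteq> image_iter m"
  by (rule lift_Suc_antimono_le[of "\<lambda>n. image_iter n"]) (rule image_iter_Suc_subset)

lemma basic_set_image:
  assumes "p \<in> \<Lambda>" "F p' = p" "p' \<in> fdom I" "\<And>n. p' \<in> image_iter n"
  shows "p' \<in> \<Lambda>"
proof -
  have "(F ^^ n) p' \<in> fdom I" for n
    using assms by (cases n) (auto simp: basic_set_iff funpow_swap1)
  then show ?thesis using assms(4) basic_set_iff by blast
qed

text \<open>Of the finitely many preimages of \<open>p\<close>, one lies in infinitely many of the decreasing sets \<open>image_iter n\<close>.\<close>

lemma basic_set_preimage:
  assumes p: "p \<in> \<Lambda>"
  shows "\<exists>p'\<in>\<Lambda>. F p' = p"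
proof -
  have ex: "\<exists>i. \<exists>p'\<in>slab i. p' \<in> image_iter n \<and> F p' = p" for n
  proof -
    obtain r where r: "r \<in> dom_iter (Suc n)" "p = F ((F ^^ n) r)"
      using p basic_set_iff[of p] by (auto dest!: spec[of _ "Suc n"])
    then have "(F ^^ n) r \<in> fdom I" "r \<in> dom_iter n" by (auto simp: iter_dom_def)
    then show ?thesis using r(2) by (auto simp: fdom_slabs)
  qed
  have "\<exists>i. \<forall>n. \<exists>p'\<in>slab i. p' \<in> image_iter n \<and> F p' = p"
  proof (rule ccontr)
    assume "\<not> ?thesis"
    then obtain N where N: "\<And>i. \<not> (\<exists>p'\<in>slab i. p' \<in> image_iter (N i) \<and> F p' = p)" by metis
    obtain i p' where i: "p' \<in> slab i" "p' \<in> image_iter (Max (range N))" "F p' = p"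
      using ex[of "Max (range N)"] by blast
    have "N i \<le> Max (range N)" by simp
    then show False using N[of i] i image_iter_antimono by blast
  qed
  then obtain i where i: "\<And>n. \<exists>p'\<in>slab i. p' \<in> image_iter n \<and> F p' = p" by blast
  then obtain p' where p': "p' \<in> slab i" "F p' = p" by blast
  \<comment> \<open>The preimage found at depth \<open>n\<close> might vary with \<open>n\<close>;
    injectivity on the slab identifies all of them with \<open>p'\<close>.\<close>
  have "p' \<in> image_iter n" for n
    using i[of n] p' inj_onD[OF inj_on_slab[of \<tau> i]] by metis
  then show ?thesis using basic_set_image[OF p p'(2) slab_fdom[OF p'(1)]] p'(2) by blast
qed

text \<open>Both claims go through one induction, because the next domain is a preimage under the
  current iterate and its closedness needs continuity of that iterate.\<close>

lemma iter_dom_closed_cont: "closed (dom_iter n) \<and> continuous_on (dom_iter n) (F ^^ n)"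
proof (induction n)
  case 0
  show ?case by (auto simp: iter_dom_def intro!: closed_Times)
next
  case (Suc n)
  have eq: "dom_iter (Suc n) = dom_iter n \<inter> (F ^^ n) -` fdom I"
    by (auto simp: iter_dom_def less_Suc_eq)
  have "continuous_on (dom_iter (Suc n)) (F \<circ> (F ^^ n))"
  proof (rule continuous_on_compose)
    show "continuous_on (dom_iter (Suc n)) (F ^^ n)"
      using Suc by (auto simp: eq intro: continuous_on_subset)
    show "continuous_on ((F ^^ n) ` dom_iter (Suc n)) F"
      by (rule continuous_on_subset[OF ftau_cont]) (auto simp: eq)
  qed
  then show ?case
    using Suc closed_fdom by (auto simp: eq comp_def intro!: continuous_closed_preimage)
qed

lemma compact_basic_set: "compact \<Lambda>"
proof -
  have cube: "compact unit_cube" by (intro compact_Times compact_Icc)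
  have dom: "compact (dom_iter n)" for n
  proof -
    have "dom_iter n = unit_cube \<inter> dom_iter n" by (auto simp: iter_dom_def)
    then show ?thesis using compact_Int_closed[OF cube, of "dom_iter n"] iter_dom_closed_cont[of n] by simp
  qed
  have "closed (iter_set unit_cube (fdom I) F n)" for n
  proof (cases "0 \<le> n")
    case True
    then show ?thesis using iter_dom_closed_cont[of "nat n"] dom[of "nat n"]
      by (simp add: iter_set_def compact_imp_closed compact_continuous_image)
  next
    case False
    let ?k = "nat \<bar>n\<bar>"
    have "closed (dom_iter ?k \<inter> (F ^^ ?k) -` unit_cube)"
      using iter_dom_closed_cont[of ?k] compact_imp_closed[OF cube]
      by (intro continuous_closed_preimage) simp_all
    then show ?thesis using False by (simp add: iter_set_def Int_def vimage_def)
  qed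
  then have "closed \<Lambda>" by (auto simp: basic_set_def)
  moreover have "\<Lambda> \<subseteq> unit_cube" using basic_set_fdom fdom_cube by blast
  ultimately show ?thesis using compact_Int_closed[OF cube, of \<Lambda>] by (simp add: Int_absorb1)
qed

section \<open>Symbolic coding of the basic set\<close>

definition pt :: "(nat \<Rightarrow> 'm) \<Rightarrow> real \<Rightarrow> real \<times> real \<times> real" where
  "pt \<omega> z = (X.fiber_pt (\<lambda>i. \<tau> $ i $ 1) \<omega> z, Y.fiber_pt (\<lambda>i. \<tau> $ i $ 2) \<omega> z, z)"

lemma pt_slab: "z \<in> {0..1} \<Longrightarrow> pt (\<lambda>k. \<omega> (Suc k)) (branch i z) \<in> slab i"
  using X.fiber_pt_range[of "\<lambda>i. \<tau> $ i $ 1", OF invariant_x, OF _ _ X.g_range]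
    Y.fiber_pt_range[of "\<lambda>i. \<tau> $ i $ 2", OF invariant_y, OF _ _ X.g_range]
    branch_in[of z i]
  by (auto simp: pt_def slab_def)

text \<open>In the coding, \<open>F\<close> prepends the symbol of the slab it is applied in; this
  is the recursion for \<open>fiber_pt\<close> in both coordinates.\<close>

lemma F_pt:
  assumes "z \<in> {0..1}"
  shows "F (pt (\<lambda>k. \<omega> (Suc k)) (branch (\<omega> 0) z)) = pt \<omega> z"
  using pt_slab[OF assms, of \<omega> "\<omega> 0"] \<psi>_branch[OF assms]
    X.fiber_pt_rec[of "\<lambda>i. \<tau> $ i $ 1" z \<omega>, OF invariant_x] 
    Y.fiber_pt_rec[of "\<lambda>i. \<tau> $ i $ 2" z \<omega>, OF invariant_y] assms
  by (simp add: pt_def slab_def ftau_eq[of _ _ _ "\<omega> 0"])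

text \<open>Backwards, the inverse branches supply coded preimages of every depth. Forwards,
  admissibility keeps the orbit in the cube, so it could leave the domain only through its height,
  which persistence excludes.\<close>

lemma pt_basic_set:
  assumes "z \<in> persistent"
  shows "pt \<omega> z \<in> \<Lambda>"
proof -
  have fd: "pt \<omega> z \<in> fdom I" if "z \<in> persistent" for \<omega> z
  proof -
    have "(\<psi> ^^ 0) z \<in> (\<Union>i. I i)" using that unfolding persistent_def by blast
    then obtain i where "z \<in> I i" by auto
    then have "z = branch i (\<psi> z)" "\<psi> z \<in> {0..1}" using branch_\<psi> \<psi>_range by auto
    \<comment> \<open>The past \<open>\<lambda>k. \<omega> (k - 1)\<close> is chosen because its
      shift is \<open>\<omega>\<close>.\<close>
    then show ?thesis using pt_slab[of "\<psi> z" "\<lambda>k. \<omega> (k - 1)" i] slab_fdom by simp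
  qed
  have img: "pt \<omega> z \<in> image_iter n" if "z \<in> persistent" for n \<omega> z
    using that
  proof (induction n arbitrary: \<omega> z)
    case 0
    then show ?case using fd fdom_cube by (auto simp: iter_dom_def)
  next
    case (Suc n)
    let ?p = "pt (\<lambda>k. \<omega> (Suc k)) (branch (\<omega> 0) z)"
    have per: "branch (\<omega> 0) z \<in> persistent" using Suc.prems by (rule persistent_branch)
    obtain r where r: "r \<in> dom_iter n" "?p = (F ^^ n) r" using Suc.IH[OF per] by blast
    have "(F ^^ n) r \<in> fdom I" using fd[OF per] r(2) by metis
    then have "r \<in> dom_iter (Suc n)" using r(1) by (auto simp: iter_dom_def less_Suc_eq)
    moreover have "pt \<omega> z = (F ^^ Suc n) r"
      using r(2) F_pt[of z \<omega>] Suc.prems by (simp add: persistent_def)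
    ultimately show ?case by blast
  qed
  have fwd: "(F ^^ n) (pt \<omega> z) \<in> fdom I" for n
  proof -
    have cube: "(F ^^ k) (pt \<omega> z) \<in> unit_cube \<and> (F ^^ k) (pt \<omega> z) \<in> fdom I" for k
    proof (induction k)
      case 0
      then show ?case using fd[OF assms] fdom_cube by auto
    next
      case (Suc k)
      then have c: "(F ^^ Suc k) (pt \<omega> z) \<in> unit_cube" using F_cube by simp
      have "snd (snd ((F ^^ Suc k) (pt \<omega> z))) \<in> (\<Union>i. I i)"
        unfolding F_iter_snd using assms by (simp only: pt_def snd_conv persistent_def mem_Collect_eq)
      then show ?case using c unfolding fdom_def mem_Times_iff by blast
    qed
    then show ?thesis by blast
  qed
  show ?thesis using img[OF assms] fwd basic_set_iff by blast
qed

text \<open>Preimages inside the basic set can be chosen repeatedly. The slabs met by this backward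
  orbit form the past \<open>\<omega>\<close>, and \<open>history_unique\<close> then determines
  both fibre coordinates.\<close>

lemma basic_set_pt:
  assumes "p \<in> \<Lambda>"
  shows "\<exists>\<omega>. p = pt \<omega> (snd (snd p))"
proof -
  obtain pre where pre: "\<And>p. p \<in> \<Lambda> \<Longrightarrow> pre p \<in> \<Lambda> \<and> F (pre p) = p"
    using basic_set_preimage by metis
  define Q where "Q n = (pre ^^ n) p" for n
  have Q: "Q n \<in> \<Lambda>" for n by (induction n) (use assms pre in \<open>auto simp: Q_def\<close>)
  have FQ: "F (Q (Suc n)) = Q n" for n using pre[OF Q[of n]] by (simp add: Q_def)
  have "\<forall>n. \<exists>i. Q (Suc n) \<in> slab i" using Q basic_set_fdom by (auto simp: fdom_slabs)
  then obtain \<omega> where \<omega>: "\<And>n. Q (Suc n) \<in> slab (\<omega> n)" by metis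
  define x y z where "x n = fst (Q n)" and "y n = fst (snd (Q n))" and "z n = snd (snd (Q n))" for n
  have Qxyz: "Q n = (x n, y n, z n)" for n by (simp add: x_def y_def z_def)
  have "Q n \<in> unit_cube" for n using Q basic_set_fdom fdom_cube by blast
  then have unit: "x n \<in> {0..1}" "y n \<in> {0..1}" "z n \<in> {0..1}" for n
    unfolding Qxyz by auto
  have zI: "z (Suc n) \<in> I (\<omega> n)" for n using \<omega>[of n] unfolding Qxyz slab_def by simp
  have rec: "x n = \<gamma> 0 (z (Suc n)) + \<tau> $ \<omega> n $ 1 + \<gamma>slope (z (Suc n)) * x (Suc n)"
    "y n = \<eta> 0 (z (Suc n)) + \<tau> $ \<omega> n $ 2 + \<eta>slope (z (Suc n)) * y (Suc n)"
    "z n = \<psi> (z (Suc n))" for n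
    using FQ[of n] unfolding Qxyz ftau_eq[OF unit(1) unit(2) zI] by simp_all
  have zb: "z (Suc n) = branch (\<omega> n) (z n)" for n
    using branch_\<psi>[OF zI[of n]] rec(3)[of n] by simp
  have "x 0 = X.fiber_pt (\<lambda>i. \<tau> $ i $ 1) \<omega> (z 0)"
    by (rule X.history_unique[of "\<lambda>i. \<tau> $ i $ 1" z \<omega> x, OF invariant_x unit(3) zb unit(1) rec(1)])
  moreover have "y 0 = Y.fiber_pt (\<lambda>i. \<tau> $ i $ 2) \<omega> (z 0)"
    by (rule Y.history_unique[of "\<lambda>i. \<tau> $ i $ 2" z \<omega> y, OF invariant_y unit(3) zb unit(2) rec(2)])
  ultimately have "p = pt \<omega> (z 0)"
    using Qxyz[of 0] by (simp add: Q_def pt_def)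
  moreover have "z 0 = snd (snd p)" by (simp add: z_def Q_def)
  ultimately show ?thesis by auto
qed

section \<open>Second preimages and the open dense set\<close>

lemma two_preimages_coincidence:
  assumes z: "z \<in> persistent" and q: "q \<in> \<Lambda>" "q \<in> slab j" "F q = pt \<omega> z" and j: "j \<noteq> \<omega> 0"
  shows "\<tau> \<in> coincidence \<omega> z"
proof -
  have z01: "z \<in> {0..1}" using z by (simp add: persistent_def)
  obtain \<upsilon> where \<upsilon>: "q = pt \<upsilon> (snd (snd q))" using basic_set_pt[OF q(1)] by blast
  \<comment> \<open>The past of the second preimage, preceded by its own slab \<open>j\<close>,
    codes the same point as \<open>\<omega>\<close> but has a different first symbol.\<close>
  define \<omega>' where "\<omega>' k = (case k of 0 \<Rightarrow> j | Suc k \<Rightarrow> \<upsilon> k)" for k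
  have "snd (snd q) \<in> I j" using q(2) by (auto simp: slab_def)
  moreover have "\<psi> (snd (snd q)) = z" using F_snd[of q] q(3) by (simp add: pt_def)
  ultimately have "snd (snd q) = branch j z" using branch_\<psi>[of "snd (snd q)" j] by simp
  then have "q = pt (\<lambda>k. \<omega>' (Suc k)) (branch (\<omega>' 0) z)" using \<upsilon> by (simp add: \<omega>'_def)
  then have eq: "pt \<omega>' z = pt \<omega> z" using F_pt[OF z01, of \<omega>'] q(3) by simp
  have "\<tau> \<in> close_set \<omega> \<omega>' z n" for n
  proof -
    have x: "\<bar>X.fiber_pt (\<lambda>i. \<tau> $ i $ 1) \<upsilon> z - X.S (\<lambda>i. \<tau> $ i $ 1) n \<upsilon> z\<bar> \<le> (1 / real CARD('m)) ^ n" for \<upsilon>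
      by (rule X.fiber_pt_approx[OF invariant_x z01])
    have y: "\<bar>Y.fiber_pt (\<lambda>i. \<tau> $ i $ 2) \<upsilon> z - Y.S (\<lambda>i. \<tau> $ i $ 2) n \<upsilon> z\<bar> \<le> (1 / real CARD('m)) ^ n" for \<upsilon>
      by (rule Y.fiber_pt_approx[OF invariant_y z01])
    show ?thesis
      using x[of \<omega>] x[of \<omega>'] y[of \<omega>] y[of \<omega>'] eq
      unfolding close_set_def pt_def mem_Collect_eq prod.inject by linarith
  qed
  moreover have "\<omega>' 0 \<noteq> \<omega> 0" using j by (simp add: \<omega>'_def)
  ultimately show ?thesis unfolding coincidence_def by blast
qed

text \<open>First a prefix length is fixed that makes all tails small. Only then is the height moved
  into \<open>Z\<close>, using continuity in \<open>z\<close> of the sums of that one depth.\<close>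

lemma pt_dense:
  assumes Z: "Z \<subseteq> persistent" "persistent \<subseteq> closure Z"
  shows "\<Lambda> \<subseteq> closure ((\<lambda>(xs, z). pt (word xs) z) ` (UNIV \<times> Z))"
    (is "_ \<subseteq> closure (?e ` _)")
proof
  fix p assume p: "p \<in> \<Lambda>"
  define z where "z = snd (snd p)"
  obtain \<omega> where \<omega>: "p = pt \<omega> z" using basic_set_pt[OF p] z_def by blast
  have per: "z \<in> persistent" unfolding z_def by (rule basic_set_persistent[OF p])
  have z01: "z \<in> {0..1}" using per by (simp add: persistent_def)
  show "p \<in> closure (?e ` (UNIV \<times> Z))"
    unfolding closure_approachable
  proof (intro allI impI)
    fix e :: real assume e: "e > 0"
    \<comment> \<open>Each fibre coordinate costs \<open>3 * d\<close>, from two tails and one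
      variation of the sum, and the height costs \<open>d\<close>; the total \<open>7 * d\<close> is
      below \<open>e\<close>.\<close>
    define d where "d = e / 10"
    have d: "d > 0" using e by (simp add: d_def)
    obtain n where n: "(1 / real CARD('m)) ^ n < d"
      using real_arch_pow_inv[OF d, of "1 / real CARD('m)"] X.q_bounds by auto
    define xs where "xs = map \<omega> [0..<n]"
    define \<omega>' where "\<omega>' = word xs"
    have S_eq: "X.S t n \<omega>' y = X.S t n \<omega> y" "Y.S t n \<omega>' y = Y.S t n \<omega> y" for t y
      by (rule fiber_sum_cong_prefix; simp add: \<omega>'_def word_def xs_def)+
    define sx where "sx = X.S (\<lambda>i. \<tau> $ i $ 1) n \<omega>"
    define sy where "sy = Y.S (\<lambda>i. \<tau> $ i $ 2) n \<omega>"
    have "continuous_on {0..1} sx" "continuous_on {0..1} sy"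
      unfolding sx_def sy_def by (rule X.continuous_on_S Y.continuous_on_S)+
    then obtain d1 d2 where d12: "d1 > 0" "d2 > 0"
      "\<And>y. y \<in> {0..1} \<Longrightarrow> dist y z < d1 \<Longrightarrow> dist (sx y) (sx z) < d"
      "\<And>y. y \<in> {0..1} \<Longrightarrow> dist y z < d2 \<Longrightarrow> dist (sy y) (sy z) < d"
      using z01 d unfolding continuous_on_iff by metis
    obtain y where y: "y \<in> Z" "dist y z < min d (min d1 d2)"
      using Z(2) per d d12(1,2) unfolding closure_approachable subset_iff by (metis min_less_iff_conj)
    have y01: "y \<in> {0..1}" using y(1) Z(1) by (auto simp: persistent_def)
    have x: "\<bar>X.fiber_pt (\<lambda>i. \<tau> $ i $ 1) \<upsilon> v - X.S (\<lambda>i. \<tau> $ i $ 1) n \<upsilon> v\<bar> \<le> (1 / real CARD('m)) ^ n"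
      if "v \<in> {0..1}" for \<upsilon> v
      by (rule X.fiber_pt_approx[OF invariant_x that])
    have yy: "\<bar>Y.fiber_pt (\<lambda>i. \<tau> $ i $ 2) \<upsilon> v - Y.S (\<lambda>i. \<tau> $ i $ 2) n \<upsilon> v\<bar> \<le> (1 / real CARD('m)) ^ n"
      if "v \<in> {0..1}" for \<upsilon> v
      by (rule Y.fiber_pt_approx[OF invariant_y that])
    have 1: "dist (fst (pt \<omega>' y)) (fst p) \<le> 3 * d"
      using x[OF y01, of \<omega>'] x[OF z01, of \<omega>] d12(3)[OF y01] y(2) n
      unfolding \<omega> pt_def S_eq sx_def[symmetric] dist_real_def by simp
    have 2: "dist (fst (snd (pt \<omega>' y))) (fst (snd p)) \<le> 3 * d"
      using yy[OF y01, of \<omega>'] yy[OF z01, of \<omega>] d12(4)[OF y01] y(2) n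
      unfolding \<omega> pt_def S_eq sy_def[symmetric] dist_real_def by simp
    have 3: "dist (snd (snd (pt \<omega>' y))) (snd (snd p)) \<le> d"
      using y(2) by (simp add: pt_def \<omega>)
    have "dist (pt \<omega>' y) p \<le> dist (fst (pt \<omega>' y)) (fst p) + dist (snd (pt \<omega>' y)) (snd p)"
      unfolding dist_prod_def by (rule sqrt_sum_squares_le_sum) auto
    also have "dist (snd (pt \<omega>' y)) (snd p) \<le>
        dist (fst (snd (pt \<omega>' y))) (fst (snd p)) + dist (snd (snd (pt \<omega>' y))) (snd (snd p))"
      unfolding dist_prod_def[of "snd _"] by (rule sqrt_sum_squares_le_sum) auto
    finally have "dist (pt \<omega>' y) p < e" using 1 2 3 d by (simp add: d_def)
    moreover have "pt \<omega>' y \<in> ?e ` (UNIV \<times> Z)"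
      using y(1) by (auto simp: \<omega>'_def image_iff intro!: exI[of _ xs])
    ultimately show "\<exists>q\<in>?e ` (UNIV \<times> Z). dist q p < e" by blast
  qed
qed

lemma open_dense_single_preimage:
  assumes Z: "Z \<subseteq> persistent" "persistent \<subseteq> closure Z"
    and good: "\<And>xs z. z \<in> Z \<Longrightarrow> \<tau> \<notin> coincidence (word xs) z"
  shows "\<exists>A. openin (top_of_set \<Lambda>) A \<and> (top_of_set \<Lambda>) closure_of A = \<Lambda> \<and>
    (\<forall>p\<in>A. \<exists>!q. q \<in> \<Lambda> \<and> F q = p)"
proof -
  \<comment> \<open>\<open>F\<close> is injective on each slab, so two preimages of a point lie in
    different slabs and \<open>B\<close> collects the points to be removed. As a finite union of
    intersections of compact images it is closed.\<close>
  define B where "B = (\<Union>i. \<Union>j\<in>- {i}. F ` (\<Lambda> \<inter> slab i) \<inter> F ` (\<Lambda> \<inter> slab j))"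
  have "closed (F ` (\<Lambda> \<inter> slab i))" for i
    by (intro compact_imp_closed compact_continuous_image continuous_on_subset[OF ftau_cont]
        compact_Int compact_basic_set compact_slab) (auto simp: fdom_slabs)
  then have "closed B" unfolding B_def by (intro closed_UN closed_Int ballI finite_UNIV finite) auto
  then have op: "openin (top_of_set \<Lambda>) (\<Lambda> - B)"
    by (metis Diff_eq open_Compl openin_open_Int)
  have uniq: "\<exists>!q. q \<in> \<Lambda> \<and> F q = p" if p: "p \<in> \<Lambda> - B" for p
  proof -
    obtain q where q: "q \<in> \<Lambda>" "F q = p" using basic_set_preimage p by blast
    have r_eq: "r = q" if r: "r \<in> \<Lambda>" "F r = p" for r
    proof -
      obtain i j where ij: "q \<in> slab i" "r \<in> slab j"
        using basic_set_fdom[OF q(1)] basic_set_fdom[OF r(1)] unfolding fdom_slabs by blast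
      have "p \<in> F ` (\<Lambda> \<inter> slab i)" "p \<in> F ` (\<Lambda> \<inter> slab j)"
        using imageI[of q "\<Lambda> \<inter> slab i" F] imageI[of r "\<Lambda> \<inter> slab j" F] q r ij by simp_all
      then have "i = j" using p unfolding B_def by blast
      then show ?thesis using ij q(2) r(2) inj_onD[OF inj_on_slab[of \<tau> i], of r q] by simp
    qed
    show ?thesis by (rule ex1I[of _ q]) (simp_all add: q r_eq)
  qed
  have "(\<lambda>(xs, z). pt (word xs) z) ` (UNIV \<times> Z) \<subseteq> \<Lambda> - B"
  proof (rule image_subsetI)
    fix w assume "w \<in> (UNIV :: 'm list set) \<times> Z"
    then obtain xs z where w: "w = (xs, z)" and z: "z \<in> Z" by blast
    have per: "z \<in> persistent" using z Z by blast
    have "pt (word xs) z \<notin> B"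
    proof
      assume "pt (word xs) z \<in> B"
      then obtain i j where ij: "i \<noteq> j" "pt (word xs) z \<in> F ` (\<Lambda> \<inter> slab i)" "pt (word xs) z \<in> F ` (\<Lambda> \<inter> slab j)"
        unfolding B_def by blast
      \<comment> \<open>Of two different slabs, at least one is not the slab of the coded
        preimage.\<close>
      obtain k where k: "k \<noteq> word xs 0" "pt (word xs) z \<in> F ` (\<Lambda> \<inter> slab k)"
        using ij by (cases "i = word xs 0") metis+
      from k(2) obtain q where q: "pt (word xs) z = F q" "q \<in> \<Lambda> \<inter> slab k" by (rule imageE)
      then have "\<tau> \<in> coincidence (word xs) z"
        using k(1) by (intro two_preimages_coincidence[OF per, of q k]) simp_all
      then show False using good[OF z] by blast
    qed
    then show "(case w of (xs, z) \<Rightarrow> pt (word xs) z) \<in> \<Lambda> - B"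
      using pt_basic_set[OF per] by (simp add: w)
  qed
  then have "\<Lambda> \<subseteq> closure (\<Lambda> - B)" using pt_dense[OF Z] closure_mono by blast
  then have "(top_of_set \<Lambda>) closure_of (\<Lambda> - B) = \<Lambda>"
    by (auto simp: closure_of_subtopology Int_absorb1 Diff_subset)
  then show ?thesis by (intro exI[of _ "\<Lambda> - B"] conjI ballI op uniq)
qed

end

text \<open>The heights \<open>Z\<close> and the pasts \<open>word xs\<close> are chosen before the
  parameter, so a single countable union of null sets contains every exceptional parameter.\<close>

lemma AE_open_dense_single_preimage:
  "AE \<tau> in lebesgue. admissible I \<gamma> \<eta> \<psi> \<tau> \<longrightarrow>
     (\<exists>A. openin (top_of_set (basic_set I \<gamma> \<eta> \<psi> \<tau>)) A \<and>
          (top_of_set (basic_set I \<gamma> \<eta> \<psi> \<tau>)) closure_of A = basic_set I \<gamma> \<eta> \<psi> \<tau> \<and>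
          (\<forall>p\<in>A. \<exists>!q. q \<in> basic_set I \<gamma> \<eta> \<psi> \<tau> \<and> ftau I \<gamma> \<eta> \<psi> \<tau> q = p))"
proof -
  obtain Z where Z: "countable Z" "Z \<subseteq> persistent" "persistent \<subseteq> closure Z"
    using separable by blast
  have "negligible (\<Union>(xs, z)\<in>UNIV \<times> Z. coincidence (word xs) z)"
    using Z(1,2) negligible_coincidence
    by (intro negligible_countable_Union) (auto simp: persistent_def)
  then have "AE \<tau> in lebesgue. \<tau> \<notin> (\<Union>(xs, z)\<in>UNIV \<times> Z. coincidence (word xs) z)"
    by (intro AE_not_in) (simp add: negligible_iff_null_sets)
  then show ?thesis
  proof (rule AE_mp, intro AE_I2 impI)
    fix \<tau> assume \<tau>: "\<tau> \<notin> (\<Union>(xs, z)\<in>UNIV \<times> Z. coincidence (word xs) z)" and adm: "admissible I \<gamma> \<eta> \<psi> \<tau>"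
    show "\<exists>A. openin (top_of_set (basic_set I \<gamma> \<eta> \<psi> \<tau>)) A \<and>
          (top_of_set (basic_set I \<gamma> \<eta> \<psi> \<tau>)) closure_of A = basic_set I \<gamma> \<eta> \<psi> \<tau> \<and>
          (\<forall>p\<in>A. \<exists>!q. q \<in> basic_set I \<gamma> \<eta> \<psi> \<tau> \<and> ftau I \<gamma> \<eta> \<psi> \<tau> q = p)"
      by (rule open_dense_single_preimage[OF adm Z(2,3)]) (use \<tau> in blast)
  qed
qed

end

section \<open>Reduction of the derivative hypotheses to the affine model\<close>

text \<open>By the mean value theorem, \<open>f\<close> multiplies all distances by \<open>r\<close>.\<close>

lemma affine_of_abs_deriv_eq:
  fixes f :: "real \<Rightarrow> real"
  assumes f: "\<And>x. x \<in> {0..1} \<Longrightarrow> (f has_real_derivative f' x) (at x within {0..1})"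
    and abs_f': "\<And>x. x \<in> {0..1} \<Longrightarrow> \<bar>f' x\<bar> = r"
  shows "\<bar>f 1 - f 0\<bar> = r"
    and "x \<in> {0..1} \<Longrightarrow> f x = f 0 + (f 1 - f 0) * x"
proof -
  have isom: "\<bar>f y - f x\<bar> = r * (y - x)" if xy: "0 \<le> x" "x \<le> y" "y \<le> 1" for x y
  proof (cases "x = y")
    case False
    then have "x < y" using xy by simp
    moreover have "(f has_derivative (*) (f' t)) (at t within {x..y})" if "x \<le> t" "t \<le> y" for t
      using DERIV_subset[OF f[of t], of "{x..y}"] that xy by (auto simp: has_field_derivative_def)
    ultimately obtain t where "t \<in> {x<..<y}" "f y - f x = f' t * (y - x)"
      using mvt_simple[of x y f "\<lambda>t. (*) (f' t)"] by blast
    then show ?thesis using abs_f'[of t] xy by (simp add: abs_mult)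
  qed simp
  show d: "\<bar>f 1 - f 0\<bar> = r" using isom[of 0 1] by simp
  show "f x = f 0 + (f 1 - f 0) * x" if "x \<in> {0..1}"
  proof -
    have "\<bar>f x - f 0\<bar> = r * x" "\<bar>f 1 - f x\<bar> = r * (1 - x)" using isom[of 0 x] isom[of x 1] that by auto
    moreover have "r * (1 - x) = r - r * x" by (simp add: algebra_simps)
    \<comment> \<open>The increments over \<open>[0, x]\<close> and \<open>[x, 1]\<close> have
      absolute values adding up to that of the whole increment, so neither can have the opposite
      sign.\<close>
    ultimately have "f x - f 0 = (if f 1 - f 0 = r then r * x else - (r * x))"
      using d by (auto split: abs_split if_splits)
    then show ?thesis using d by (auto simp: algebra_simps split: if_splits abs_split)
  qed
qed

theorem corollary3:
  fixes I :: "'m::finite \<Rightarrow> real set"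
    and \<gamma> \<eta> \<gamma>x \<eta>y :: "real \<Rightarrow> real \<Rightarrow> real"
    and \<psi> \<psi>' :: "real \<Rightarrow> real"
    and \<epsilon> L1 L2 :: real
  assumes "CARD('m) \<ge> 3"
    and "\<And>i. \<exists>a b. a \<le> b \<and> I i = {a..b}"
    and "\<And>i. I i \<subseteq> {0<..<1}"
    and "\<And>i j. i \<noteq> j \<Longrightarrow> I i \<inter> I j = {}"
    and "\<epsilon> > 0"
    and "C1_holder_on \<epsilon> (fmap \<gamma> \<eta> \<psi>) (fdom I)"
    and "\<And>x z. x \<in> {0..1} \<Longrightarrow> z \<in> (\<Union>i. I i) \<Longrightarrow>
           ((\<lambda>t. \<gamma> t z) has_real_derivative \<gamma>x x z) (at x within {0..1})"
    and "\<And>y z. y \<in> {0..1} \<Longrightarrow> z \<in> (\<Union>i. I i) \<Longrightarrow>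
           ((\<lambda>t. \<eta> t z) has_real_derivative \<eta>y y z) (at y within {0..1})"
    and "\<And>z. z \<in> (\<Union>i. I i) \<Longrightarrow> (\<psi> has_real_derivative \<psi>' z) (at z within (\<Union>i. I i))"
    and "0 < L1" and "L1 < L2" and "L2 < 1/2"
    and "\<And>x z. x \<in> {0..1} \<Longrightarrow> z \<in> (\<Union>i. I i) \<Longrightarrow> L1 < \<bar>\<gamma>x x z\<bar> \<and> \<bar>\<gamma>x x z\<bar> < L2"
    and "\<And>y z. y \<in> {0..1} \<Longrightarrow> z \<in> (\<Union>i. I i) \<Longrightarrow> L1 < \<bar>\<eta>y y z\<bar> \<and> \<bar>\<eta>y y z\<bar> < L2"
    and "\<And>z. z \<in> (\<Union>i. I i) \<Longrightarrow> \<bar>\<psi>' z\<bar> > 1"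
    and "\<And>i. \<psi> ` I i = {0..1}"
    and "\<And>x z. x \<in> {0..1} \<Longrightarrow> z \<in> (\<Union>i. I i) \<Longrightarrow> \<bar>\<gamma>x x z\<bar> = 1 / real CARD('m)"
    and "\<And>y z. y \<in> {0..1} \<Longrightarrow> z \<in> (\<Union>i. I i) \<Longrightarrow> \<bar>\<eta>y y z\<bar> = 1 / real CARD('m)"
  shows "AE \<tau> in lebesgue. admissible I \<gamma> \<eta> \<psi> \<tau> \<longrightarrow>
           (\<exists>A. openin (top_of_set (basic_set I \<gamma> \<eta> \<psi> \<tau>)) A \<and>
                (top_of_set (basic_set I \<gamma> \<eta> \<psi> \<tau>)) closure_of A = basic_set I \<gamma> \<eta> \<psi> \<tau> \<and>
                (\<forall>p\<in>A. \<exists>!q. q \<in> basic_set I \<gamma> \<eta> \<psi> \<tau> \<and> ftau I \<gamma> \<eta> \<psi> \<tau> q = p))"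
proof -
  let ?U = "\<Union>i. I i"
  have m: "CARD('m) \<ge> 3" using assms by simp
  have U_fdom: "(x, y, z) \<in> fdom I" if "x \<in> {0, 1}" "y \<in> {0, 1}" "z \<in> ?U" for x y z
    using that by (auto simp: fdom_def)
  obtain f' where "\<forall>p\<in>fdom I. (fmap \<gamma> \<eta> \<psi> has_derivative blinfun_apply (f' p)) (at p within fdom I)"
    using assms(6) unfolding C1_holder_on_def by blast
  then have f_cont: "continuous_on (fdom I) (fmap \<gamma> \<eta> \<psi>)"
    by (intro has_derivative_continuous_on) blast
  \<comment> \<open>Restricting to the points \<open>(x, x, z)\<close> yields continuity in
    \<open>z\<close> of both fibre coordinates at the end point \<open>x\<close> from one continuous
    map.\<close>
  have f_line: "continuous_on ?U (\<lambda>z. fmap \<gamma> \<eta> \<psi> (x, x, z))" if "x \<in> {0, 1}" for x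
    by (rule continuous_on_compose2[OF f_cont]) (use that U_fdom in \<open>auto intro!: continuous_intros\<close>)
  \<comment> \<open>On an interval, a derivative without zeros forces injectivity by the mean value
    theorem.\<close>
  have \<psi>_inj: "inj_on \<psi> (I i)" for i
  proof -
    obtain a b where ab: "I i = {a..b}" using assms(2) by blast
    have "\<psi> v \<noteq> \<psi> u" if uv: "u \<in> I i" "v \<in> I i" "u < v" for u v
    proof -
      have sub: "{u..v} \<subseteq> I i" using uv ab by auto
      have "(\<psi> has_derivative (*) (\<psi>' t)) (at t within {u..v})" if "u \<le> t" "t \<le> v" for t
        using DERIV_subset[OF assms(9)[of t], of "{u..v}"] that sub by (fastforce simp: has_field_derivative_def)
      then obtain t where t: "t \<in> {u<..<v}" "\<psi> v - \<psi> u = \<psi>' t * (v - u)"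
        using mvt_simple[OF uv(3), of \<psi> "\<lambda>t. (*) (\<psi>' t)"] by blast
      have "t \<in> ?U" using t(1) sub by fastforce
      then have "\<psi>' t \<noteq> 0" using assms(15)[of t] by auto
      then show ?thesis using t(2) uv(3) by auto
    qed
    then show ?thesis by (intro linorder_inj_onI) (auto simp: eq_commute)
  qed
  interpret skew_product I \<gamma> \<eta> \<psi>
  proof
    show "CARD('m) \<ge> 3" by (rule m)
    show "compact (I i)" for i using assms(2)[of i] by auto
    show "I i \<subseteq> {0..1}" for i using assms(3)[of i] by fastforce
    show "i \<noteq> j \<Longrightarrow> I i \<inter> I j = {}" for i j by (rule assms(4))
    show "inj_on \<psi> (I i)" for i by (rule \<psi>_inj)
    show "\<psi> ` I i = {0..1}" for i by (rule assms(16))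
    show "continuous_on ?U \<psi>" by (rule DERIV_continuous_on) (rule assms(9))
    show "continuous_on ?U (\<gamma> x)" if "x \<in> {0, 1}" for x
      using continuous_on_fst[OF f_line[OF that]] by (simp add: fmap_def)
    show "continuous_on ?U (\<eta> x)" if "x \<in> {0, 1}" for x
      using continuous_on_fst[OF continuous_on_snd[OF f_line[OF that]]] by (simp add: fmap_def)
    show "\<gamma> x z = \<gamma> 0 z + (\<gamma> 1 z - \<gamma> 0 z) * x" if "x \<in> {0..1}" "z \<in> ?U" for x z
      by (rule affine_of_abs_deriv_eq(2)[where f = "\<lambda>t. \<gamma> t z", OF assms(7)[OF _ that(2)] assms(17)[OF _ that(2)] that(1)])
    show "\<eta> x z = \<eta> 0 z + (\<eta> 1 z - \<eta> 0 z) * x" if "x \<in> {0..1}" "z \<in> ?U" for x z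
      by (rule affine_of_abs_deriv_eq(2)[where f = "\<lambda>t. \<eta> t z", OF assms(8)[OF _ that(2)] assms(18)[OF _ that(2)] that(1)])
    show "\<bar>\<gamma> 1 z - \<gamma> 0 z\<bar> = 1 / real CARD('m)" if "z \<in> ?U" for z
      by (rule affine_of_abs_deriv_eq(1)[where f = "\<lambda>t. \<gamma> t z", OF assms(7)[OF _ that] assms(17)[OF _ that]])
    show "\<bar>\<eta> 1 z - \<eta> 0 z\<bar> = 1 / real CARD('m)" if "z \<in> ?U" for z
      by (rule affine_of_abs_deriv_eq(1)[where f = "\<lambda>t. \<eta> t z", OF assms(8)[OF _ that] assms(18)[OF _ that]])
  qed
  show ?thesis by (rule AE_open_dense_single_preimage)
qed

end
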